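(* Let $p\in(0,1)$, and let $F$ and $G$ be any two cdf's from $\mathcal{F}^{-}_{1}$. Then $$\int_0^p \big( G^{-1}(u)-F^{-1}(u) \big)\, du =\int_{-\infty }^{F^{-1}(p)} \big( F(x)- G(x)\big)\, dx + \mathrm{Rem}(p;F,G),$$ where the remainder term $$\mathrm{Rem}(p;F,G) =\int^{F^{-1}(p)}_{G^{-1}(p)} \big( G(x)-p\big)\, dx$$ is non-negative and satisfies the bounds $$\mathrm{Rem}(p;F,G) \le \int^{F^{-1}(p)}_{G^{-1}(p)} \big( G(x) - F(x)\big)\, dx \le \big| G^{-1}(p)-F^{-1}(p)\big|\,\sup_{x\in \mathbb{R}} \big| G(x) - F(x)\big| .$$
   Context: A cdf is the cumulative distribution function $F(x)=\mathbb{P}(X\le x)$ of a real-valued random variable. The quantile function of a cdf $F$ is $F^{-1}(u)=\inf\{x\in\mathbb{R}: F(x)\ge u\}$ for $u\in(0,1]$ and $F^{-1}(0)=\lim_{u\downarrow 0}F^{-1}(u)$. The class $\mathcal{F}^{-}_{1}$ consists of all cdf's $F$ for which $\int_0^p F^{-1}(u)\,du$ is finite (for $p\in(0,1)$); equivalently, $\mathbb{E}(X^{-})<\infty$ for $X\sim F$, where $X^{-}=(-X)\vee 0$. Integrals are oriented: $\int_a^b=-\int_b^a$ when $a>b$. *)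

theory Defs
  imports "HOL-Probability.Probability"
begin

(* The law of a real-valued random variable is exactly a real_distribution,
   so M plays the role of the law of X and cdf M x = P(X <= x). *)
definition is_cdf :: "(real \<Rightarrow> real) \<Rightarrow> bool" where
  "is_cdf F \<longleftrightarrow> (\<exists>M. real_distribution M \<and> F = cdf M)"

(* Extended-real valued: the value may be -\<infinity> at u = 0 and \<infinity> at u = 1.
   Only arguments u in [0,1] are meaningful. *)
definition quantile :: "(real \<Rightarrow> real) \<Rightarrow> real \<Rightarrow> ereal" where
  "quantile F u =
     (let Q = (\<lambda>v::real. INF x \<in> {x. F x \<ge> v}. ereal x)
      in if u = 0 then Lim (at_right 0) Q else Q u)"

lemma quantile_finite:
  assumes F: "is_cdf F" and u: "0 < u" "u < 1"
  shows "\<bar>quantile F u\<bar> \<noteq> \<infinity>"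
proof -
  obtain M where M: "real_distribution M" and FM: "F = cdf M"
    using F by (auto simp: is_cdf_def)
  interpret real_distribution M by (rule M)
  have "eventually (\<lambda>x. u < F x) at_top"
    using order_tendstoD(1)[OF cdf_lim_at_top_prob u(2)] by (simp add: FM)
  then obtain b where b: "u < F b"
    by (auto simp: eventually_at_top_linorder)
  have "eventually (\<lambda>x. F x < u) at_bot"
    using order_tendstoD(2)[OF cdf_lim_at_bot u(1)] by (simp add: FM)
  then obtain a where a: "F a < u"
    by (auto simp: eventually_at_bot_linorder)
  have lower: "a \<le> x" if "u \<le> F x" for x
  proof (rule ccontr)
    assume "\<not> a \<le> x"
    then have "F x \<le> F a" by (simp add: FM cdf_nondecreasing)
    with a that show False by simp
  qed
  have "ereal a \<le> quantile F u"
    using u lower by (auto simp: quantile_def intro!: INF_greatest)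
  moreover have "quantile F u \<le> ereal b"
    using u b by (auto simp: quantile_def intro!: INF_lower)
  ultimately show ?thesis by auto
qed

(* The quantile function is nondecreasing, hence bounded above on (0,p), so the
   integral over (0,p) is finite precisely when the integrand is integrable. *)
definition F1_minus :: "(real \<Rightarrow> real) set" where
  "F1_minus = {F. is_cdf F \<and>
     (\<forall>p\<in>{0<..<1::real}.
        interval_lebesgue_integrable lborel 0 (ereal p) (\<lambda>u. real_of_ereal (quantile F u)))}"

definition Rem :: "real \<Rightarrow> (real \<Rightarrow> real) \<Rightarrow> (real \<Rightarrow> real) \<Rightarrow> real" where
  "Rem p F G = (LBINT x=quantile G p..quantile F p. (G x - p))"

end

theory Submission
  imports Defs
begin

text \<open>
  The Galois connection \<open>F\<^sup>-\<^sup>1(u) \<le> x \<longleftrightarrow> u \<le> F x\<close> shows that \<open>F < p\<close> strictly to the left of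
  \<open>F\<^sup>-\<^sup>1(p)\<close> and \<open>F \<ge> p\<close> to the right of it, which gives all inequalities. Computing
  the area under the graph of \<open>F\<close> to the left of \<open>F\<^sup>-\<^sup>1(p)\<close> along both coordinate axes (Tonelli)
  gives \<open>\<integral>\<^sub>0\<^sup>p (F\<^sup>-\<^sup>1(p) - F\<^sup>-\<^sup>1(u)) du = \<integral> F x dx\<close> over \<open>x < F\<^sup>-\<^sup>1(p)\<close>. Subtracting this identity for
  \<open>G\<close> from the one for \<open>F\<close> leaves the remainder as the oriented integral of \<open>G - p\<close>.
\<close>

lemma is_cdf_mono: "is_cdf F \<Longrightarrow> mono F"
  by (auto simp: is_cdf_def intro!: monoI finite_borel_measure.cdf_nondecreasing
      real_distribution.finite_borel_measure_M)

lemma is_cdf_measurable [measurable]: "is_cdf F \<Longrightarrow> F \<in> borel_measurable borel"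
  by (intro borel_measurable_mono is_cdf_mono)

lemma is_cdf_range:
  assumes "is_cdf F"
  shows "0 \<le> F x" "F x \<le> 1"
proof -
  obtain M where M: "real_distribution M" and FM: "F = cdf M"
    using assms by (auto simp: is_cdf_def)
  interpret real_distribution M by (rule M)
  show "0 \<le> F x" "F x \<le> 1"
    by (auto simp: FM cdf_nonneg cdf_bounded_prob)
qed

text \<open>From right to left, \<open>x\<close> belongs to the set whose infimum is the quantile.
  From left to right, right-continuity of a cdf makes this infimum attained. For
  \<open>0 < u < 1\<close> the quantile is finite, so \<open>real_of_ereal\<close> never falls back
  on its default value 0.\<close>

lemma quantile_le_iff:
  assumes F: "is_cdf F" and u: "0 < u" "u < 1"
  shows "real_of_ereal (quantile F u) \<le> x \<longleftrightarrow> u \<le> F x"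
proof
  obtain M where M: "real_distribution M" and FM: "F = cdf M"
    using F by (auto simp: is_cdf_def)
  interpret real_distribution M by (rule M)
  define q where "q = real_of_ereal (quantile F u)"
  have "ereal q = quantile F u"
    using quantile_finite[OF F u] by (simp add: q_def ereal_real)
  then have q: "ereal q = (INF y \<in> {y. u \<le> F y}. ereal y)"
    using u by (simp add: quantile_def)
  show "q \<le> x" if "u \<le> F x"
  proof -
    have "ereal q \<le> ereal x" unfolding q using that by (auto intro: INF_lower)
    then show ?thesis by simp
  qed
  show "u \<le> F x" if "q \<le> x"
  proof -
    \<comment> \<open>Every \<open>y > x\<close> exceeds the infimum, so a point of the set lies
      below \<open>y\<close>, and monotonicity carries the bound to \<open>y\<close>. Letting
      \<open>y\<close> decrease to \<open>x\<close> then gives the bound at \<open>x\<close>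
      itself.\<close>
    have above: "u \<le> F y" if "x < y" for y
    proof -
      have "(INF y \<in> {y. u \<le> F y}. ereal y) < ereal y"
        using that \<open>q \<le> x\<close> q by (metis ereal_less(2) less_ereal.simps(1) order_le_less_trans)
      then obtain z where "u \<le> F z" "z < y" by (auto simp: INF_less_iff)
      then show ?thesis using monoD[OF is_cdf_mono[OF F], of z y] by linarith
    qed
    have "(F \<longlongrightarrow> F x) (at_right x)"
      using cdf_is_right_cont[of x] by (simp add: FM continuous_within)
    moreover have "eventually (\<lambda>y. u \<le> F y) (at_right x)"
      using above by (auto simp: eventually_at_right_field intro: exI[of _ "x + 1"])
    ultimately show ?thesis
      by (rule tendsto_lowerbound) simp
  qed
qed

lemma set_integrable_bounded:
  fixes f :: "real \<Rightarrow> real"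
  assumes [measurable]: "f \<in> borel_measurable borel" "A \<in> sets borel"
    and A: "bounded A" and bound: "\<And>x. \<bar>f x\<bar> \<le> B"
  shows "set_integrable lborel A f"
  unfolding set_integrable_def
  by (rule integrableI_bounded_set_indicator[where B=B])
    (use bound emeasure_bounded_finite[OF A] in auto)

lemma interval_integrable_bounded:
  fixes f :: "real \<Rightarrow> real"
  assumes "f \<in> borel_measurable borel" and "\<And>x. \<bar>f x\<bar> \<le> B"
  shows "interval_lebesgue_integrable lborel (ereal a) (ereal b) f"
  using assms by (auto simp: interval_lebesgue_integrable_def intro!: set_integrable_bounded)

text \<open>Membership in \<open>F1_minus\<close> makes the area under \<open>F\<close> left of
  \<open>b\<close> finite, so integrability of \<open>F\<close> near -\<infinity> comes out as a
  conclusion. The area identity is solved for the quantile integral, ready for subtracting two such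
  identities.\<close>

lemma interval_integral_quantile:
  assumes F: "F \<in> F1_minus" and p: "0 < p" "p < 1"
  defines "b \<equiv> real_of_ereal (quantile F p)"
  shows "interval_lebesgue_integrable lborel (-\<infinity>) (ereal b) F"
    and "(LBINT u=0..ereal p. real_of_ereal (quantile F u)) = p * b - (LBINT x=-\<infinity>..ereal b. F x)"
proof -
  define Q where "Q u = real_of_ereal (quantile F u)" for u
  have cdf: "is_cdf F" and Qint: "set_integrable lborel {0<..<p} Q"
    using F p by (auto simp: F1_minus_def interval_lebesgue_integrable_def Q_def[abs_def] zero_ereal_def)
  note [measurable] = is_cdf_measurable[OF cdf]
  have Q_le: "Q u \<le> x \<longleftrightarrow> u \<le> F x" if "0 < u" "u < 1" for u x
    unfolding Q_def using quantile_le_iff[OF cdf that] .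
  have F_less: "F x < p" if "x < b" for x
    using Q_le[OF p, of x] that by (auto simp: Q_def b_def)
  have Qb: "Q u \<le> b" if "0 < u" "u < p" for u
    using that p Q_le[of u b] Q_le[OF p, of b] by (auto simp: Q_def b_def)
  have const: "set_integrable lborel {0<..<p} (\<lambda>u. b)"
    by (rule set_integrable_bounded[where B="\<bar>b\<bar>"]) auto
  have gap: "set_integrable lborel {0<..<p} (\<lambda>u. b - Q u)"
    by (intro set_integral_diff const Qint)
  \<comment> \<open>Since \<open>u \<le> F x\<close> means \<open>Q u \<le> x\<close>, the section
    at fixed \<open>u\<close> is the interval [Q u, b), and the section at fixed \<open>x\<close> is
    (0, F x].\<close>
  define A where "A = {(u, x). 0 < u \<and> u < p \<and> u \<le> F x \<and> x < b}"
  have A [measurable]: "A \<in> sets (lborel \<Otimes>\<^sub>M lborel)"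
  proof -
    have "Measurable.pred (borel \<Otimes>\<^sub>M borel) (\<lambda>z. 0 < fst z \<and> fst z < p \<and> fst z \<le> F (snd z) \<and> snd z < b)"
      by measurable
    then have "{z \<in> space (borel \<Otimes>\<^sub>M borel). 0 < fst z \<and> fst z < p \<and> fst z \<le> F (snd z) \<and> snd z < b}
        \<in> sets (borel \<Otimes>\<^sub>M borel)" by (rule predE)
    also have "{z \<in> space (borel \<Otimes>\<^sub>M borel). 0 < fst z \<and> fst z < p \<and> fst z \<le> F (snd z) \<and> snd z < b} = A"
      by (auto simp: A_def space_pair_measure)
    finally show ?thesis by (simp add: sets_pair_measure_cong[OF sets_lborel sets_lborel])
  qed
  have section_u: "(\<integral>\<^sup>+x. indicator A (u, x) \<partial>lborel) = ennreal (indicator {0<..<p} u *\<^sub>R (b - Q u))" for u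
  proof (cases "0 < u \<and> u < p")
    case True
    then have "(\<integral>\<^sup>+x. indicator A (u, x) \<partial>lborel) = (\<integral>\<^sup>+x. indicator {Q u..<b} x \<partial>lborel)"
      using p Q_le by (intro nn_integral_cong) (auto simp: A_def split: split_indicator)
    then show ?thesis using True Qb by simp
  qed (auto simp: A_def)
  \<comment> \<open>The cut \<open>u < p\<close> removes nothing here, because
    \<open>F x < p\<close> to the left of \<open>b\<close>.\<close>
  have section_x: "(\<integral>\<^sup>+u. indicator A (u, x) \<partial>lborel) = ennreal (indicator {..<b} x *\<^sub>R F x)" for x
  proof (cases "x < b")
    case True
    then have "(\<integral>\<^sup>+u. indicator A (u, x) \<partial>lborel) = (\<integral>\<^sup>+u. indicator {0<..F x} u \<partial>lborel)"
      using F_less[OF True] by (intro nn_integral_cong) (auto simp: A_def split: split_indicator)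
    then show ?thesis using True is_cdf_range[OF cdf, of x] by simp
  qed (auto simp: A_def)
  \<comment> \<open>Nonnegativity allows the exchange before \<open>F\<close> is known to be
    integrable; finiteness enters afterwards through \<open>gap\<close>.\<close>
  have "(\<integral>\<^sup>+x. ennreal (indicator {..<b} x *\<^sub>R F x) \<partial>lborel)
      = (\<integral>\<^sup>+u. ennreal (indicator {0<..<p} u *\<^sub>R (b - Q u)) \<partial>lborel)"
    unfolding section_u[symmetric] section_x[symmetric]
    by (rule lborel_pair.Fubini') simp
  also have "\<dots> = ennreal (LINT u:{0<..<p}|lborel. b - Q u)"
    using gap Qb unfolding set_integrable_def set_lebesgue_integral_def
    by (intro nn_integral_eq_integral) (auto split: split_indicator)
  finally have area: "(\<integral>\<^sup>+x. ennreal (indicator {..<b} x *\<^sub>R F x) \<partial>lborel)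
      = ennreal (LINT u:{0<..<p}|lborel. b - Q u)" .
  have gap_nonneg: "0 \<le> (LINT u:{0<..<p}|lborel. b - Q u)"
    unfolding set_lebesgue_integral_def
    using Qb by (intro integral_nonneg_AE) (auto split: split_indicator)
  have "has_bochner_integral lborel (\<lambda>x. indicator {..<b} x *\<^sub>R F x) (LINT u:{0<..<p}|lborel. b - Q u)"
    using area gap_nonneg is_cdf_range[OF cdf] by (intro has_bochner_integral_nn_integral) auto
  then have Fint: "set_integrable lborel {..<b} F"
    and Feq: "(LINT x:{..<b}|lborel. F x) = (LINT u:{0<..<p}|lborel. b - Q u)"
    by (auto simp: has_bochner_integral_iff set_integrable_def set_lebesgue_integral_def)
  show "interval_lebesgue_integrable lborel (-\<infinity>) (ereal b) F"
    using Fint by (simp add: interval_lebesgue_integrable_def)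
  have "(LINT u:{0<..<p}|lborel. b - Q u) = p * b - (LINT u:{0<..<p}|lborel. Q u)"
    using p by (simp add: set_integral_diff(2)[OF const Qint] set_integral_const)
  then show "(LBINT u=0..ereal p. real_of_ereal (quantile F u)) = p * b - (LBINT x=-\<infinity>..ereal b. F x)"
    using Feq p by (simp add: interval_lebesgue_integral_def Q_def zero_ereal_def)
qed

text \<open>For \<open>b < a\<close> the oriented integral is minus the ordinary one, so the
  integrands must compare the other way round there. At most one of \<open>fwd\<close> and
  \<open>bwd\<close> has content, which covers both orders of the two quantiles without a case
  split.\<close>

lemma interval_integral_mono_oriented:
  fixes f g :: "real \<Rightarrow> real"
  assumes f: "interval_lebesgue_integrable lborel (ereal a) (ereal b) f"
    and g: "interval_lebesgue_integrable lborel (ereal a) (ereal b) g"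
    and fwd: "\<And>x. a < x \<Longrightarrow> x < b \<Longrightarrow> f x \<le> g x"
    and bwd: "\<And>x. b < x \<Longrightarrow> x < a \<Longrightarrow> g x \<le> f x"
  shows "(LBINT x=ereal a..ereal b. f x) \<le> (LBINT x=ereal a..ereal b. g x)"
  using f g fwd bwd
  by (auto simp: interval_lebesgue_integral_def interval_lebesgue_integrable_def
      split: if_splits intro!: set_integral_mono)

text \<open>A non-integrable function has integral 0 by convention; the four integrability claims
  ensure that the identity and the bounds concern genuine integrals.\<close>

theorem theorem5p1:
  fixes p :: real and F G :: "real \<Rightarrow> real"
  assumes "0 < p" and "p < 1"
    and "F \<in> F1_minus" and "G \<in> F1_minus"
  shows
    "interval_lebesgue_integrable lborel 0 (ereal p)
        (\<lambda>u. real_of_ereal (quantile G u) - real_of_ereal (quantile F u)) \<and>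
     interval_lebesgue_integrable lborel (-\<infinity>) (quantile F p) (\<lambda>x. F x - G x) \<and>
     interval_lebesgue_integrable lborel (quantile G p) (quantile F p) (\<lambda>x. G x - p) \<and>
     interval_lebesgue_integrable lborel (quantile G p) (quantile F p) (\<lambda>x. G x - F x) \<and>
     (LBINT u=0..ereal p. (real_of_ereal (quantile G u) - real_of_ereal (quantile F u)))
       = (LBINT x=-\<infinity>..quantile F p. (F x - G x)) + Rem p F G \<and>
     0 \<le> Rem p F G \<and>
     Rem p F G \<le> (LBINT x=quantile G p..quantile F p. (G x - F x)) \<and>
     (LBINT x=quantile G p..quantile F p. (G x - F x))
       \<le> \<bar>real_of_ereal (quantile G p) - real_of_ereal (quantile F p)\<bar>
          * (SUP x. \<bar>G x - F x\<bar>)"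
proof -
  note p = assms(1,2)
  have F: "is_cdf F" and G: "is_cdf G" using assms(3,4) by (auto simp: F1_minus_def)
  note [measurable] = is_cdf_measurable[OF F] is_cdf_measurable[OF G]
  define a where "a = real_of_ereal (quantile G p)"
  define b where "b = real_of_ereal (quantile F p)"
  have qG: "quantile G p = ereal a" and qF: "quantile F p = ereal b"
    using quantile_finite[OF G p] quantile_finite[OF F p] by (auto simp: a_def b_def ereal_real)
  have Ga: "p \<le> G x \<longleftrightarrow> a \<le> x" for x using quantile_le_iff[OF G p] by (simp add: a_def)
  have Fb: "p \<le> F x \<longleftrightarrow> b \<le> x" for x using quantile_le_iff[OF F p] by (simp add: b_def)
  have Ga_less: "G x < p \<longleftrightarrow> x < a" and Fb_less: "F x < p \<longleftrightarrow> x < b" for x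
    using Ga[of x] Fb[of x] by linarith+
  have diff_le: "\<bar>G x - F x\<bar> \<le> 1" for x
    using is_cdf_range[OF F, of x] is_cdf_range[OF G, of x] by auto
  \<comment> \<open>The supremum is taken in the reals, so it bounds the values only once they are
    known to be bounded above.\<close>
  have bdd: "bdd_above (range (\<lambda>x. \<bar>G x - F x\<bar>))"
    using diff_le by (auto intro!: bdd_aboveI[of _ 1])
  define S where "S = (SUP x. \<bar>G x - F x\<bar>)"
  have abs_le_S: "\<bar>G x - F x\<bar> \<le> S" for x
    unfolding S_def by (rule cSUP_upper[OF _ bdd]) simp
  have S: "G x - F x \<le> S" "- S \<le> G x - F x" for x
    using abs_le_S[of x] by linarith+

  have QG: "interval_lebesgue_integrable lborel 0 (ereal p) (\<lambda>u. real_of_ereal (quantile G u))"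
    and QF: "interval_lebesgue_integrable lborel 0 (ereal p) (\<lambda>u. real_of_ereal (quantile F u))"
    using assms by (auto simp: F1_minus_def)
  have intQ: "interval_lebesgue_integrable lborel 0 (ereal p)
        (\<lambda>u. real_of_ereal (quantile G u) - real_of_ereal (quantile F u))"
    by (rule interval_lebesgue_integral_diff(1)[OF QG QF])
  note IF = interval_integral_quantile[OF assms(3) p, folded b_def]
  note IG = interval_integral_quantile[OF assms(4) p, folded a_def]
  have intG: "interval_lebesgue_integrable lborel (ereal c) (ereal d) G" for c d
    using is_cdf_range[OF G] by (intro interval_integrable_bounded[where B=1]) auto
  \<comment> \<open>The area identity gives integrability of \<open>G\<close> only up to its own
    quantile \<open>a\<close>. If \<open>a < b\<close>, the missing piece is bounded. Splitting an
    oriented integral at \<open>a\<close> needs integrability up to the larger endpoint.\<close>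
  have G_max: "interval_lebesgue_integrable lborel (-\<infinity>) (ereal (max a b)) G"
  proof (cases "a \<le> b")
    case True
    have "set_integrable lborel {..<a} G"
      using IG(1) by (simp add: interval_lebesgue_integrable_def)
    moreover have "set_integrable lborel {a..<b} G"
      using is_cdf_range[OF G] by (intro set_integrable_bounded[where B=1]) auto
    ultimately have "set_integrable lborel ({..<a} \<union> {a..<b}) G"
      by (rule set_integrable_Un) auto
    then have "set_integrable lborel {..<b} G"
      by (rule set_integrable_subset) (use True in auto)
    then show ?thesis using True by (simp add: interval_lebesgue_integrable_def max_def)
  qed (use IG(1) in \<open>simp add: max_def\<close>)
  have G_b: "interval_lebesgue_integrable lborel (-\<infinity>) (ereal b) G"
  proof -
    have "set_integrable lborel {..<max a b} G"
      using G_max by (simp add: interval_lebesgue_integrable_def del: ereal_max)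
    then have "set_integrable lborel {..<b} G"
      by (rule set_integrable_subset) auto
    then show ?thesis by (simp add: interval_lebesgue_integrable_def)
  qed
  have G_split: "(LBINT x=-\<infinity>..ereal a. G x) + (LBINT x=ereal a..ereal b. G x) = (LBINT x=-\<infinity>..ereal b. G x)"
    by (rule interval_integral_sum) (use G_max in \<open>auto simp: min_def max_def split: if_splits\<close>)
  have intFG: "interval_lebesgue_integrable lborel (-\<infinity>) (ereal b) (\<lambda>x. F x - G x)"
    by (rule interval_lebesgue_integral_diff(1)[OF IF(1) G_b])
  have intc: "interval_lebesgue_integrable lborel (ereal a) (ereal b) (\<lambda>x. c)" for c :: real
    by (intro interval_integrable_bounded[where B="\<bar>c\<bar>"]) auto
  have intGp: "interval_lebesgue_integrable lborel (ereal a) (ereal b) (\<lambda>x. G x - p)"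
    by (rule interval_lebesgue_integral_diff(1)[OF intG intc])
  have intGF: "interval_lebesgue_integrable lborel (ereal a) (ereal b) (\<lambda>x. G x - F x)"
    using diff_le by (intro interval_integrable_bounded[where B=1]) auto

  have Rem: "Rem p F G = (LBINT x=ereal a..ereal b. G x - p)"
    by (simp add: Rem_def qG qF)
  also have "\<dots> = (LBINT x=ereal a..ereal b. G x) - p * (b - a)"
    by (simp add: interval_lebesgue_integral_diff(2)[OF intG intc])
  finally have Rem_eq: "Rem p F G = (LBINT x=ereal a..ereal b. G x) - p * (b - a)" .
  \<comment> \<open>Subtracting the identities leaves \<open>p * a - p * b\<close>, the constant
    part of \<open>Rem\<close>, and \<open>G_split\<close> moves the upper limit of the integral of
    \<open>G\<close> from \<open>a\<close> to \<open>b\<close>.\<close>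
  have main: "(LBINT u=0..ereal p. (real_of_ereal (quantile G u) - real_of_ereal (quantile F u)))
       = (LBINT x=-\<infinity>..ereal b. (F x - G x)) + Rem p F G"
    using G_split
    by (simp add: Rem_eq interval_lebesgue_integral_diff(2)[OF QG QF] IF(2) IG(2)
        interval_lebesgue_integral_diff(2)[OF IF(1) G_b] algebra_simps)
  \<comment> \<open>\<open>G x - p\<close> changes sign at \<open>a\<close>: it is nonnegative on
    (a, b) and negative on (b, a), as the orientation requires.\<close>
  have "(LBINT x=ereal a..ereal b. 0) \<le> (LBINT x=ereal a..ereal b. G x - p)"
    by (intro interval_integral_mono_oriented intGp intc) (auto simp: Ga less_imp_le Ga_less)
  then have nonneg: "0 \<le> Rem p F G" by (simp add: Rem)
  \<comment> \<open>Replacing \<open>p\<close> by \<open>F x\<close> raises the integrand left of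
    \<open>b\<close>, where \<open>F x < p\<close>, and does not raise it right of \<open>b\<close>,
    where the orientation is reversed.\<close>
  have le: "Rem p F G \<le> (LBINT x=ereal a..ereal b. G x - F x)"
    unfolding Rem
    by (intro interval_integral_mono_oriented intGp intGF) (auto simp: Fb less_imp_le Fb_less)
  \<comment> \<open>With reversed orientation the integrand has to be bounded from below, hence by
    \<open>- S\<close>; in both cases \<open>s * (b - a)\<close> equals
    \<open>\<bar>a - b\<bar> * S\<close>.\<close>
  define s where "s = (if a \<le> b then S else - S)"
  have "(LBINT x=ereal a..ereal b. G x - F x) \<le> (LBINT x=ereal a..ereal b. s)"
    by (intro interval_integral_mono_oriented intGF intc) (simp_all add: s_def S)
  also have "\<dots> = \<bar>a - b\<bar> * S" by (simp add: s_def algebra_simps)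
  finally have sup: "(LBINT x=ereal a..ereal b. G x - F x) \<le> \<bar>a - b\<bar> * S" .
  show ?thesis
    using intQ intFG intGp intGF main nonneg le sup
    by (simp add: qG qF S_def)
qed

end
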